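(* For any prime $\ell\neq p$, the base change $\underline{Z}^1(W_F^0/P_F^e,\hat G)_{\mathbb{Z}_\ell}$ is independent of the choices made to define the subgroup $W_F^0$, up to canonical isomorphism. Namely, let $W_F^{0\prime}$ be another choice of subgroup; then there is a unique isomorphism of $\mathbb{Z}_\ell$-schemes $\underline{Z}^1(W_F^0/P_F^e,\hat G)_{\mathbb{Z}_\ell}\xrightarrow{\sim}\underline{Z}^1(W_F^{0\prime}/P_F^e,\hat G)_{\mathbb{Z}_\ell}$ compatible with the universal $\ell$-adically continuous $1$-cocycles on each side.
   Context: $F$ is a non-archimedean local field of residue characteristic $p$ with residue field of cardinality $q$; $W_F\supset I_F\supset P_F$ are its Weil group, inertia and wild inertia subgroups. $\hat G$ is a split reductive group scheme (connected geometric fibres) over $\mathbb{Z}[\frac1p]$ with an action of $W_F$ factoring through a finite quotient $W$; ${}^LG=\hat G\rtimes W$. Given a lift of arithmetic Frobenius $\mathrm{Fr}\in W_F/P_F$ and a topological generator $s$ of $I_F/P_F$, one has $\mathrm{Fr}\,s\,\mathrm{Fr}^{-1}=s^q$ and $W_F^0$ is the preimage in $W_F$ of $\langle\mathrm{Fr},s\rangle=s^{\mathbb{Z}[1/q]}\rtimes\mathrm{Fr}^{\mathbb{Z}}\subset W_F/P_F$, with the topology for which $P_F$ (profinite topology) is open and $W_F^0/P_F$ is discrete. "Another choice" means the subgroup obtained from another pair $(\mathrm{Fr}',s')$. $P_F^e$ is an open subgroup of $P_F$, normal in $W_F$, acting trivially on $\hat G$. $\underline{Z}^1(W_F^0/P_F^e,\hat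 G)=\mathrm{Spec}\,R^e$ is the affine $\mathbb{Z}[\frac1p]$-scheme representing $R\mapsto Z^1(W_F^0/P_F^e,\hat G(R))$ ($1$-cocycles). A cocycle $\varphi:W_F\to\hat G(R)$ over a Noetherian $\mathbb{Z}_\ell$-algebra $R$ is $\ell$-adically continuous if either (a) $R$ is $\ell$-adically separated ($\bigcap_n\ell^nR=0$) and for every $n>0$ the preimage under ${}^L\varphi=(\varphi,\mathrm{id})$ of $\ker({}^LG(R)\to{}^LG(R/\ell^nR))$ is open in $W_F$, or (b) $\varphi$ is the pushforward, along a $\mathbb{Z}_\ell$-algebra morphism $R'\to R$, of a cocycle satisfying (a) over some Noetherian $\ell$-adically separated $R'$. The universal cocycle $W_F^0/P_F^e\to\hat G(R^e)$ extends uniquely to an $\ell$-adically continuous cocycle $W_F/P_F^e\to\hat G(R^e\otimes\mathbb{Z}_\ell)$, which is universal among $\ell$-adically continuous cocycles on $W_F/P_F^e$; this is the "universal $\ell$-adically continuous $1$-cocycle". *)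

theory Defs
  imports "HOL-Analysis.Analysis" "HOL-Algebra.Algebra"
begin

section \<open>Local fields and Weil groups\<close>

text \<open>
  The type \<open>'k\<close> is a separable closure of the local field \<open>F\<close>, and \<open>nrm\<close> is the
  (unique) extension to \<open>'k\<close> of an absolute value defining the topology of \<open>F\<close>.
\<close>

definition residue_card :: "'k::field set \<Rightarrow> ('k \<Rightarrow> real) \<Rightarrow> nat" where
  "residue_card F nrm =
     card ({x \<in> F. nrm x \<le> 1} // {(x, y). x \<in> F \<and> y \<in> F \<and> nrm x \<le> 1 \<and> nrm y \<le> 1 \<and> nrm (x - y) < 1})"

locale nonarch_local_field =
  fixes F :: "'k::field set" and nrm :: "'k \<Rightarrow> real" and p :: nat
  assumes one_in_F: "1 \<in> F"
    and diff_in_F: "x \<in> F \<Longrightarrow> y \<in> F \<Longrightarrow> x - y \<in> F"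
    and mult_in_F: "x \<in> F \<Longrightarrow> y \<in> F \<Longrightarrow> x * y \<in> F"
    and inverse_in_F: "x \<in> F \<Longrightarrow> inverse x \<in> F"
    and nrm_nonneg: "0 \<le> nrm x"
    and nrm_eq_0: "nrm x = 0 \<longleftrightarrow> x = 0"
    and nrm_mult: "nrm (x * y) = nrm x * nrm y"
    and nrm_ultrametric: "nrm (x + y) \<le> max (nrm x) (nrm y)"
    and discretely_valued:
      "\<exists>\<pi>\<in>F. 0 < nrm \<pi> \<and> nrm \<pi> < 1 \<and> (\<forall>x\<in>F. x \<noteq> 0 \<longrightarrow> (\<exists>k::int. nrm x = nrm \<pi> powi k))"
    and complete:
      "range c \<subseteq> F \<Longrightarrow> (\<And>e. 0 < e \<Longrightarrow> \<exists>M. \<forall>m\<ge>M. \<forall>n\<ge>M. nrm (c m - c n) < e)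
        \<Longrightarrow> \<exists>L\<in>F. (\<lambda>n. nrm (c n - L)) \<longlonglongrightarrow> 0"
    and finite_residue_field:
      "finite ({x \<in> F. nrm x \<le> 1} // {(x, y). x \<in> F \<and> y \<in> F \<and> nrm x \<le> 1 \<and> nrm y \<le> 1 \<and> nrm (x - y) < 1})"
    and residue_char: "Factorial_Ring.prime p" "nrm (of_nat p) < 1"
    and separable_algebraic:
      "\<exists>f :: 'k Polynomial.poly. f \<noteq> 0 \<and> (\<forall>i. Polynomial.coeff f i \<in> F)
         \<and> Rings.coprime f (pderiv f) \<and> poly f z = 0"
    and separably_closed:
      "Rings.coprime g (pderiv (g :: 'k Polynomial.poly)) \<Longrightarrow> 0 < Polynomial.degree g \<Longrightarrow> \<exists>z. poly g z = 0"

definition galois_group :: "'k::field set \<Rightarrow> ('k \<Rightarrow> 'k) monoid" where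
  "galois_group F =
     \<lparr>carrier = {\<sigma>. bij \<sigma> \<and> (\<forall>x y. \<sigma> (x + y) = \<sigma> x + \<sigma> y) \<and> (\<forall>x y. \<sigma> (x * y) = \<sigma> x * \<sigma> y)
                   \<and> (\<forall>x\<in>F. \<sigma> x = x)},
      monoid.mult = (\<lambda>\<sigma> \<tau>. \<sigma> \<circ> \<tau>), one = id\<rparr>"

text \<open>\<open>\<sigma>\<close> induces the automorphism \<open>x \<mapsto> x ^ (q ^ n)\<close>, respectively its inverse, on the residue field
  of \<open>'k\<close>, which is an algebraic closure of the residue field of \<open>F\<close>.\<close>

definition acts_as_frob :: "'k::field set \<Rightarrow> ('k \<Rightarrow> real) \<Rightarrow> nat \<Rightarrow> ('k \<Rightarrow> 'k) \<Rightarrow> bool" where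
  "acts_as_frob F nrm n \<sigma> \<longleftrightarrow> (\<forall>x. nrm x \<le> 1 \<longrightarrow> nrm (\<sigma> x - x ^ (residue_card F nrm ^ n)) < 1)"

definition acts_as_inverse_frob :: "'k::field set \<Rightarrow> ('k \<Rightarrow> real) \<Rightarrow> nat \<Rightarrow> ('k \<Rightarrow> 'k) \<Rightarrow> bool" where
  "acts_as_inverse_frob F nrm n \<sigma> \<longleftrightarrow>
     (\<forall>x. nrm x \<le> 1 \<longrightarrow> nrm (\<sigma> x ^ (residue_card F nrm ^ n) - x) < 1)"

definition weil_group :: "'k::field set \<Rightarrow> ('k \<Rightarrow> real) \<Rightarrow> ('k \<Rightarrow> 'k) monoid" where
  "weil_group F nrm = (galois_group F)\<lparr>carrier :=
     {\<sigma> \<in> carrier (galois_group F). \<exists>n. acts_as_frob F nrm n \<sigma> \<or> acts_as_inverse_frob F nrm n \<sigma>}\<rparr>"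

definition inertia :: "'k::field set \<Rightarrow> ('k \<Rightarrow> real) \<Rightarrow> ('k \<Rightarrow> 'k) set" where
  "inertia F nrm = {\<sigma> \<in> carrier (galois_group F). \<forall>x. nrm x \<le> 1 \<longrightarrow> nrm (\<sigma> x - x) < 1}"

text \<open>The ramification group of the valued field \<open>'k\<close> over \<open>F\<close>.\<close>

definition wild_inertia :: "'k::field set \<Rightarrow> ('k \<Rightarrow> real) \<Rightarrow> ('k \<Rightarrow> 'k) set" where
  "wild_inertia F nrm = {\<sigma> \<in> carrier (galois_group F). \<forall>x. x \<noteq> 0 \<longrightarrow> nrm (\<sigma> x - x) < nrm x}"

text \<open>The inertia group is open and carries the Krull topology, in which the pointwise
  stabilisers of finite sets are a neighbourhood basis of the identity.\<close>

definition weil_openin :: "'k::field set \<Rightarrow> ('k \<Rightarrow> real) \<Rightarrow> ('k \<Rightarrow> 'k) set \<Rightarrow> bool" where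
  "weil_openin F nrm U \<longleftrightarrow> U \<subseteq> carrier (weil_group F nrm) \<and>
     (\<forall>\<sigma>\<in>U. \<exists>S. finite S \<and>
        {\<tau> \<in> \<sigma> <#\<^bsub>weil_group F nrm\<^esub> inertia F nrm. \<forall>x\<in>S. \<tau> x = \<sigma> x} \<subseteq> U)"

definition weil_topology :: "'k::field set \<Rightarrow> ('k \<Rightarrow> real) \<Rightarrow> ('k \<Rightarrow> 'k) topology" where
  "weil_topology F nrm = topology (weil_openin F nrm)"

lemma istopology_weil_openin: "istopology (weil_openin F nrm)"
  unfolding istopology_def
proof (intro conjI allI impI)
  fix U V assume UV: "weil_openin F nrm U" "weil_openin F nrm V"
  show "weil_openin F nrm (U \<inter> V)"
    unfolding weil_openin_def
  proof (intro conjI ballI)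
    show "U \<inter> V \<subseteq> carrier (weil_group F nrm)"
      using UV by (auto simp: weil_openin_def)
  next
    fix \<sigma> assume "\<sigma> \<in> U \<inter> V"
    then obtain S S' where "finite S" "finite S'"
      and "{\<tau> \<in> \<sigma> <#\<^bsub>weil_group F nrm\<^esub> inertia F nrm. \<forall>x\<in>S. \<tau> x = \<sigma> x} \<subseteq> U"
      and "{\<tau> \<in> \<sigma> <#\<^bsub>weil_group F nrm\<^esub> inertia F nrm. \<forall>x\<in>S'. \<tau> x = \<sigma> x} \<subseteq> V"
      using UV unfolding weil_openin_def by blast
    then show "\<exists>S. finite S \<and>
        {\<tau> \<in> \<sigma> <#\<^bsub>weil_group F nrm\<^esub> inertia F nrm. \<forall>x\<in>S. \<tau> x = \<sigma> x} \<subseteq> U \<inter> V"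
      by (intro exI[of _ "S \<union> S'"]) auto
  qed
next
  fix \<K> assume "\<forall>K\<in>\<K>. weil_openin F nrm K"
  then show "weil_openin F nrm (\<Union>\<K>)"
    unfolding weil_openin_def by (fast intro: order_trans[OF _ Union_upper])
qed

definition quotient_topology :: "'a topology \<Rightarrow> ('a \<Rightarrow> 'b) \<Rightarrow> 'b topology" where
  "quotient_topology Y f =
     topology (\<lambda>U. U \<subseteq> f ` topspace Y \<and> openin Y {x \<in> topspace Y. f x \<in> U})"

lemma istopology_quotient:
  "istopology (\<lambda>U. U \<subseteq> f ` topspace Y \<and> openin Y {x \<in> topspace Y. f x \<in> U})"
  unfolding istopology_def
proof (intro conjI allI impI)
  fix S T
  assume S: "S \<subseteq> f ` topspace Y \<and> openin Y {x \<in> topspace Y. f x \<in> S}"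
    and T: "T \<subseteq> f ` topspace Y \<and> openin Y {x \<in> topspace Y. f x \<in> T}"
  show "S \<inter> T \<subseteq> f ` topspace Y" using S by blast
  have "{x \<in> topspace Y. f x \<in> S \<inter> T} = {x \<in> topspace Y. f x \<in> S} \<inter> {x \<in> topspace Y. f x \<in> T}"
    by auto
  then show "openin Y {x \<in> topspace Y. f x \<in> S \<inter> T}" using S T by auto
next
  fix \<K>
  assume K: "\<forall>K\<in>\<K>. K \<subseteq> f ` topspace Y \<and> openin Y {x \<in> topspace Y. f x \<in> K}"
  show "\<Union>\<K> \<subseteq> f ` topspace Y" using K by blast
  have "{x \<in> topspace Y. f x \<in> \<Union>\<K>} = \<Union>((\<lambda>K. {x \<in> topspace Y. f x \<in> K}) ` \<K>)"
    by auto
  moreover have "openin Y (\<Union>((\<lambda>K. {x \<in> topspace Y. f x \<in> K}) ` \<K>))"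
    using K by (intro openin_Union) auto
  ultimately show "openin Y {x \<in> topspace Y. f x \<in> \<Union>\<K>}" by simp
qed

definition arithmetic_frobenius_lift ::
    "'k::field set \<Rightarrow> ('k \<Rightarrow> real) \<Rightarrow> ('k \<Rightarrow> 'k) set \<Rightarrow> bool" where
  "arithmetic_frobenius_lift F nrm Fr \<longleftrightarrow>
     Fr \<in> carrier (weil_group F nrm Mod wild_inertia F nrm) \<and> (\<forall>\<sigma>\<in>Fr. acts_as_frob F nrm 1 \<sigma>)"

definition tame_generator :: "'k::field set \<Rightarrow> ('k \<Rightarrow> real) \<Rightarrow> ('k \<Rightarrow> 'k) set \<Rightarrow> bool" where
  "tame_generator F nrm s \<longleftrightarrow>
     (let tame = (weil_group F nrm)\<lparr>carrier := inertia F nrm\<rparr> Mod wild_inertia F nrm;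
          Q = quotient_topology (subtopology (weil_topology F nrm) (inertia F nrm))
                (\<lambda>\<sigma>. wild_inertia F nrm #>\<^bsub>weil_group F nrm\<^esub> \<sigma>)
      in s \<in> carrier tame \<and> Q closure_of (generate tame {s}) = carrier tame)"

definition discrete_weil_group ::
    "'k::field set \<Rightarrow> ('k \<Rightarrow> real) \<Rightarrow> ('k \<Rightarrow> 'k) set \<Rightarrow> ('k \<Rightarrow> 'k) set \<Rightarrow> ('k \<Rightarrow> 'k) set" where
  "discrete_weil_group F nrm Fr s =
     {w \<in> carrier (weil_group F nrm). wild_inertia F nrm #>\<^bsub>weil_group F nrm\<^esub> w
        \<in> generate (weil_group F nrm Mod wild_inertia F nrm) {Fr, s}}"


section \<open>Affine group schemes over \<open>\<int>[1/p]\<close>\<close>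

text \<open>
  All rings of coordinates and all test rings have their carrier in one type \<open>'u\<close>, which plays
  the role of a universe; universal properties and functors of points refer to it.  Once \<open>'u\<close> has
  at least the cardinality of the continuum, the schemes considered here and the base changes of
  their coordinate rings to \<open>\<int>\<^sub>l\<close> fit into \<open>'u\<close>, and the notions below agree with the absolute ones.

  A \<open>\<int>[1/p]\<close>-algebra is a commutative ring in which \<open>p\<close> is invertible, and every ring
  homomorphism between two such is \<open>\<int>[1/p]\<close>-linear.  Affine schemes are represented by their
  coordinate rings, so a morphism of affine schemes is a ring homomorphism in the opposite direction.
\<close>

definition zp_algebra :: "nat \<Rightarrow> 'u ring \<Rightarrow> bool" where
  "zp_algebra p R \<longleftrightarrow> cring R \<and> add_pow R p \<one>\<^bsub>R\<^esub> \<in> Units R"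

definition alg_hom :: "'a ring \<Rightarrow> 'b ring \<Rightarrow> ('a \<Rightarrow> 'b) set" where
  "alg_hom R S = ring_hom R S \<inter> extensional (carrier R)"

record 'u group_scheme =
  coord :: "'u ring"
  pts :: "'u ring \<Rightarrow> ('u \<Rightarrow> 'u) monoid"

definition push :: "'u group_scheme \<Rightarrow> ('u \<Rightarrow> 'u) \<Rightarrow> ('u \<Rightarrow> 'u) \<Rightarrow> ('u \<Rightarrow> 'u)" where
  "push G f g = compose (carrier (coord G)) f g"

definition affine_group_scheme :: "nat \<Rightarrow> 'u group_scheme \<Rightarrow> bool" where
  "affine_group_scheme p G \<longleftrightarrow> zp_algebra p (coord G) \<and>
     (\<forall>R. zp_algebra p R \<longrightarrow> group (pts G R) \<and> carrier (pts G R) = alg_hom (coord G) R) \<and>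
     (\<forall>R S. \<forall>f\<in>ring_hom R S. zp_algebra p R \<and> zp_algebra p S \<longrightarrow>
        push G f \<in> hom (pts G R) (pts G S))"

text \<open>Finite presentation amounts to finite type because \<open>\<int>[1/p]\<close> is Noetherian.\<close>

definition smooth_algebra :: "nat \<Rightarrow> 'u ring \<Rightarrow> bool" where
  "smooth_algebra p A \<longleftrightarrow>
     (\<exists>S. finite S \<and> S \<subseteq> carrier A \<and>
        generate_ring A (insert (inv\<^bsub>A\<^esub> (add_pow A p \<one>\<^bsub>A\<^esub>)) S) = carrier A) \<and>
     (\<forall>(C :: 'u ring) I f.
        zp_algebra p C \<and> ideal I C \<and> (\<forall>x\<in>I. \<forall>y\<in>I. x \<otimes>\<^bsub>C\<^esub> y = \<zero>\<^bsub>C\<^esub>) \<and> f \<in> ring_hom A (C Quot I)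
        \<longrightarrow> (\<exists>g\<in>ring_hom A C. \<forall>a\<in>carrier A. f a = I +>\<^bsub>C\<^esub> g a))"


subsection \<open>Geometric fibres\<close>

text \<open>For an algebraically closed field \<open>k\<close>, the fibre of a smooth group scheme over \<open>k\<close> is reduced,
  and is treated as the linear algebraic group formed by its \<open>k\<close>-points.\<close>

inductive_set function_algebra :: "'u ring \<Rightarrow> 'a set \<Rightarrow> ('a \<Rightarrow> 'u) set \<Rightarrow> ('a \<Rightarrow> 'u) set"
  for k :: "'u ring" and D :: "'a set" and E :: "('a \<Rightarrow> 'u) set" where
  const: "c \<in> carrier k \<Longrightarrow> (\<lambda>x\<in>D. c) \<in> function_algebra k D E"
| gen: "f \<in> E \<Longrightarrow> restrict f D \<in> function_algebra k D E"
| add: "f \<in> function_algebra k D E \<Longrightarrow> g \<in> function_algebra k D E \<Longrightarrow>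
    (\<lambda>x\<in>D. f x \<oplus>\<^bsub>k\<^esub> g x) \<in> function_algebra k D E"
| mult: "f \<in> function_algebra k D E \<Longrightarrow> g \<in> function_algebra k D E \<Longrightarrow>
    (\<lambda>x\<in>D. f x \<otimes>\<^bsub>k\<^esub> g x) \<in> function_algebra k D E"

definition regular_functions :: "'u group_scheme \<Rightarrow> 'u ring \<Rightarrow> (('u \<Rightarrow> 'u) \<Rightarrow> 'u) set" where
  "regular_functions G k =
     function_algebra k (carrier (pts G k)) ((\<lambda>a g. g a) ` carrier (coord G))"

definition zariski :: "'u group_scheme \<Rightarrow> 'u ring \<Rightarrow> ('u \<Rightarrow> 'u) topology" where
  "zariski G k = topology_generated_by
     {{g \<in> carrier (pts G k). f g \<noteq> \<zero>\<^bsub>k\<^esub>} | f. f \<in> regular_functions G k}"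

text \<open>\<open>u\<close> is unipotent if right translation by \<open>u\<close> on regular functions is locally unipotent.\<close>

definition unipotent_element :: "'u group_scheme \<Rightarrow> 'u ring \<Rightarrow> ('u \<Rightarrow> 'u) \<Rightarrow> bool" where
  "unipotent_element G k u \<longleftrightarrow>
     (\<forall>f\<in>regular_functions G k. \<exists>n.
        ((\<lambda>h. \<lambda>g\<in>carrier (pts G k). h (g \<otimes>\<^bsub>pts G k\<^esub> u) \<ominus>\<^bsub>k\<^esub> h g) ^^ n) f
        = (\<lambda>g\<in>carrier (pts G k). \<zero>\<^bsub>k\<^esub>))"

definition connected_reductive_fibre :: "'u group_scheme \<Rightarrow> 'u ring \<Rightarrow> bool" where
  "connected_reductive_fibre G k \<longleftrightarrow> connected_space (zariski G k) \<and>
     (\<forall>H. H \<lhd> pts G k \<and> closedin (zariski G k) H \<and> connectedin (zariski G k) H \<and>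
        (\<forall>u\<in>H. unipotent_element G k u) \<longrightarrow> H = {\<one>\<^bsub>pts G k\<^esub>})"

definition reductive_group_scheme :: "nat \<Rightarrow> 'u group_scheme \<Rightarrow> bool" where
  "reductive_group_scheme p G \<longleftrightarrow> affine_group_scheme p G \<and> smooth_algebra p (coord G) \<and>
     (\<forall>k. algebraically_closed k \<and> zp_algebra p k \<longrightarrow> connected_reductive_fibre G k)"


subsection \<open>Split maximal tori\<close>

definition torus_points :: "nat \<Rightarrow> 'u ring \<Rightarrow> (nat \<Rightarrow> 'u) monoid" where
  "torus_points r R = product_group {..<r} (\<lambda>_. units_of R)"

text \<open>The last condition says that restriction of functions along \<open>\<psi>\<close> maps onto the Laurent
  polynomials, so that \<open>\<psi>\<close> is an isomorphism of algebraic groups from a split torus onto \<open>H\<close>.\<close>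

definition torus_in_fibre :: "'u group_scheme \<Rightarrow> 'u ring \<Rightarrow> ('u \<Rightarrow> 'u) set \<Rightarrow> bool" where
  "torus_in_fibre G k H \<longleftrightarrow> subgroup H (pts G k) \<and> closedin (zariski G k) H \<and>
     (\<exists>n \<psi>. \<psi> \<in> iso (torus_points n k) ((pts G k)\<lparr>carrier := H\<rparr>) \<and>
        (\<lambda>f. compose (carrier (torus_points n k)) f \<psi>) ` regular_functions G k =
        function_algebra k (carrier (torus_points n k))
          ((\<lambda>i t. t i) ` {..<n} \<union> (\<lambda>i t. inv\<^bsub>k\<^esub> (t i)) ` {..<n}))"

definition closed_points :: "'u group_scheme \<Rightarrow> 'u set \<Rightarrow> 'u ring \<Rightarrow> ('u \<Rightarrow> 'u) set" where
  "closed_points G J R = {g \<in> carrier (pts G R). \<forall>a\<in>J. g a = \<zero>\<^bsub>R\<^esub>}"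

definition split_subtorus :: "nat \<Rightarrow> 'u group_scheme \<Rightarrow> 'u set \<Rightarrow> bool" where
  "split_subtorus p G J \<longleftrightarrow> ideal J (coord G) \<and>
     (\<exists>r \<Lambda>. (\<forall>R. zp_algebra p R \<longrightarrow>
               \<Lambda> R \<in> iso (torus_points r R) ((pts G R)\<lparr>carrier := closed_points G J R\<rparr>)) \<and>
            (\<forall>R S. \<forall>f\<in>ring_hom R S. zp_algebra p R \<and> zp_algebra p S \<longrightarrow>
               (\<forall>t\<in>carrier (torus_points r R). push G f (\<Lambda> R t) = \<Lambda> S (\<lambda>i\<in>{..<r}. f (t i)))))"

text \<open>Over the connected base \<open>Spec \<int>[1/p]\<close>, whose Picard group is trivial, the existence of a
  split maximal torus implies the remaining conditions in the definition of a split group: roots and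
  coroots are constant and root spaces are free.\<close>

definition split_reductive :: "nat \<Rightarrow> 'u group_scheme \<Rightarrow> bool" where
  "split_reductive p G \<longleftrightarrow> reductive_group_scheme p G \<and>
     (\<exists>J. split_subtorus p G J \<and>
        (\<forall>k. algebraically_closed k \<and> zp_algebra p k \<longrightarrow>
           torus_in_fibre G k (closed_points G J k) \<and>
           (\<forall>H. torus_in_fibre G k H \<and> closed_points G J k \<subseteq> H \<longrightarrow> H = closed_points G J k)))"


section \<open>Group actions and cocycles\<close>

definition group_scheme_action ::
    "nat \<Rightarrow> 'u group_scheme \<Rightarrow> 'w monoid \<Rightarrow> ('w \<Rightarrow> 'u ring \<Rightarrow> ('u \<Rightarrow> 'u) \<Rightarrow> ('u \<Rightarrow> 'u)) \<Rightarrow> bool" where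
  "group_scheme_action p G \<Gamma> act \<longleftrightarrow>
     (\<forall>w\<in>carrier \<Gamma>. \<forall>R. zp_algebra p R \<longrightarrow> act w R \<in> iso (pts G R) (pts G R)) \<and>
     (\<forall>w\<in>carrier \<Gamma>. \<forall>R S. \<forall>f\<in>ring_hom R S. zp_algebra p R \<and> zp_algebra p S \<longrightarrow>
        (\<forall>g\<in>carrier (pts G R). act w S (push G f g) = push G f (act w R g))) \<and>
     (\<forall>R. zp_algebra p R \<longrightarrow> (\<forall>g\<in>carrier (pts G R). act \<one>\<^bsub>\<Gamma>\<^esub> R g = g \<and>
        (\<forall>v\<in>carrier \<Gamma>. \<forall>w\<in>carrier \<Gamma>. act (v \<otimes>\<^bsub>\<Gamma>\<^esub> w) R g = act v R (act w R g))))"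

definition acts_trivially ::
    "nat \<Rightarrow> 'u group_scheme \<Rightarrow> ('w \<Rightarrow> 'u ring \<Rightarrow> ('u \<Rightarrow> 'u) \<Rightarrow> ('u \<Rightarrow> 'u)) \<Rightarrow> 'w set \<Rightarrow> bool" where
  "acts_trivially p G act H \<longleftrightarrow>
     (\<forall>w\<in>H. \<forall>R. zp_algebra p R \<longrightarrow> (\<forall>g\<in>carrier (pts G R). act w R g = g))"

text \<open>The action of a quotient by a subgroup that acts trivially; the choice of representative
  does not matter.\<close>

definition coset_act ::
    "('w \<Rightarrow> 'u ring \<Rightarrow> ('u \<Rightarrow> 'u) \<Rightarrow> ('u \<Rightarrow> 'u)) \<Rightarrow> 'w set \<Rightarrow> 'u ring \<Rightarrow> ('u \<Rightarrow> 'u) \<Rightarrow> ('u \<Rightarrow> 'u)" where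
  "coset_act act Y = act (SOME w. w \<in> Y)"

definition cocycles ::
    "'w monoid \<Rightarrow> ('w \<Rightarrow> 'u ring \<Rightarrow> ('u \<Rightarrow> 'u) \<Rightarrow> ('u \<Rightarrow> 'u)) \<Rightarrow> 'u group_scheme \<Rightarrow> 'u ring
      \<Rightarrow> ('w \<Rightarrow> ('u \<Rightarrow> 'u)) set" where
  "cocycles \<Gamma> act G R = {\<phi> \<in> carrier \<Gamma> \<rightarrow>\<^sub>E carrier (pts G R).
     \<forall>v\<in>carrier \<Gamma>. \<forall>w\<in>carrier \<Gamma>. \<phi> (v \<otimes>\<^bsub>\<Gamma>\<^esub> w) = \<phi> v \<otimes>\<^bsub>pts G R\<^esub> act v R (\<phi> w)}"

definition push_cocycle ::
    "'w monoid \<Rightarrow> 'u group_scheme \<Rightarrow> ('u \<Rightarrow> 'u) \<Rightarrow> ('w \<Rightarrow> ('u \<Rightarrow> 'u)) \<Rightarrow> ('w \<Rightarrow> ('u \<Rightarrow> 'u))" where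
  "push_cocycle \<Gamma> G f \<phi> = (\<lambda>w\<in>carrier \<Gamma>. push G f (\<phi> w))"

text \<open>\<open>Spec R\<close>, with universal cocycle \<open>\<phi>\<close>, represents the functor \<open>C \<mapsto> Z\<^sup>1(\<Gamma>, G(C))\<close>.\<close>

definition represents_cocycles ::
    "nat \<Rightarrow> 'u group_scheme \<Rightarrow> 'w monoid \<Rightarrow> ('w \<Rightarrow> 'u ring \<Rightarrow> ('u \<Rightarrow> 'u) \<Rightarrow> ('u \<Rightarrow> 'u))
      \<Rightarrow> 'u ring \<Rightarrow> ('w \<Rightarrow> ('u \<Rightarrow> 'u)) \<Rightarrow> bool" where
  "represents_cocycles p G \<Gamma> act R \<phi> \<longleftrightarrow> zp_algebra p R \<and> \<phi> \<in> cocycles \<Gamma> act G R \<and>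
     (\<forall>C \<psi>. zp_algebra p C \<and> \<psi> \<in> cocycles \<Gamma> act G C \<longrightarrow>
        (\<exists>!f. f \<in> alg_hom R C \<and> push_cocycle \<Gamma> G f \<phi> = \<psi>))"


section \<open>\<open>\<ell>\<close>-adic coefficients\<close>

definition padic_integers :: "nat \<Rightarrow> (nat \<Rightarrow> int) ring" where
  "padic_integers l =
     \<lparr>carrier = {x. \<forall>n. x n \<in> {0..<int l ^ n} \<and> x (Suc n) mod int l ^ n = x n},
      monoid.mult = (\<lambda>x y n. (x n * y n) mod int l ^ n), one = (\<lambda>n. 1 mod int l ^ n),
      ring.zero = (\<lambda>n. 0), ring.add = (\<lambda>x y n. (x n + y n) mod int l ^ n)\<rparr>"

definition zl_algebra :: "nat \<Rightarrow> 'u ring \<Rightarrow> ((nat \<Rightarrow> int) \<Rightarrow> 'u) \<Rightarrow> bool" where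
  "zl_algebra l C \<eta> \<longleftrightarrow> cring C \<and> \<eta> \<in> ring_hom (padic_integers l) C"

definition zl_hom ::
    "nat \<Rightarrow> 'u ring \<Rightarrow> ((nat \<Rightarrow> int) \<Rightarrow> 'u) \<Rightarrow> 'u ring \<Rightarrow> ((nat \<Rightarrow> int) \<Rightarrow> 'u) \<Rightarrow> ('u \<Rightarrow> 'u) set" where
  "zl_hom l C \<eta> D \<theta> =
     {f \<in> alg_hom C D. \<forall>a\<in>carrier (padic_integers l). f (\<eta> a) = \<theta> a}"

text \<open>\<open>T\<close> is \<open>R \<otimes> \<int>\<^sub>l\<close>: the tensor product, over \<open>\<int>\<close> or equivalently over \<open>\<int>[1/p]\<close>, is the
  coproduct of commutative rings.\<close>

definition base_change_zl ::
    "nat \<Rightarrow> 'u ring \<Rightarrow> 'u ring \<Rightarrow> ('u \<Rightarrow> 'u) \<Rightarrow> ((nat \<Rightarrow> int) \<Rightarrow> 'u) \<Rightarrow> bool" where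
  "base_change_zl l R T i j \<longleftrightarrow> zl_algebra l T j \<and> i \<in> ring_hom R T \<and>
     (\<forall>(C :: 'u ring) f g. cring C \<and> f \<in> ring_hom R C \<and> g \<in> ring_hom (padic_integers l) C \<longrightarrow>
        (\<exists>!h. h \<in> alg_hom T C \<and> (\<forall>x\<in>carrier R. h (i x) = f x) \<and>
              (\<forall>a\<in>carrier (padic_integers l). h (j a) = g a)))"

definition adic_ideal :: "nat \<Rightarrow> nat \<Rightarrow> 'u ring \<Rightarrow> 'u set" where
  "adic_ideal l n R = PIdl\<^bsub>R\<^esub> (add_pow R (l ^ n) \<one>\<^bsub>R\<^esub>)"

definition adically_separated :: "nat \<Rightarrow> 'u ring \<Rightarrow> bool" where
  "adically_separated l R \<longleftrightarrow> (\<Inter>n. adic_ideal l n R) = {\<zero>\<^bsub>R\<^esub>}"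

text \<open>The group \<open>\<^sup>LG(R) = G(R) \<rtimes> (\<Gamma>/N)\<close>, where \<open>\<Gamma>/N\<close> is the finite quotient that acts.\<close>

definition L_group ::
    "'w monoid \<Rightarrow> 'w set \<Rightarrow> ('w \<Rightarrow> 'u ring \<Rightarrow> ('u \<Rightarrow> 'u) \<Rightarrow> ('u \<Rightarrow> 'u)) \<Rightarrow> 'u group_scheme \<Rightarrow> 'u ring
      \<Rightarrow> (('u \<Rightarrow> 'u) \<times> 'w set) monoid" where
  "L_group \<Gamma> N act G R =
     \<lparr>carrier = carrier (pts G R) \<times> carrier (\<Gamma> Mod N),
      monoid.mult = (\<lambda>(g, x) (h, y). (g \<otimes>\<^bsub>pts G R\<^esub> coset_act act x R h, x \<otimes>\<^bsub>\<Gamma> Mod N\<^esub> y)),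
      one = (\<one>\<^bsub>pts G R\<^esub>, \<one>\<^bsub>\<Gamma> Mod N\<^esub>)\<rparr>"

text \<open>The kernel of \<open>\<^sup>LG(R) \<rightarrow> \<^sup>LG(R/l\<^sup>nR)\<close>.  The neutral element of \<open>G(R/I)\<close> is the image of the
  neutral element of \<open>G(R)\<close>, and points of \<open>G(R/I)\<close> are homomorphisms from the coordinate ring to
  \<open>R Quot I\<close>.\<close>

definition L_congruence_kernel ::
    "'w monoid \<Rightarrow> 'w set \<Rightarrow> ('w \<Rightarrow> 'u ring \<Rightarrow> ('u \<Rightarrow> 'u) \<Rightarrow> ('u \<Rightarrow> 'u)) \<Rightarrow> 'u group_scheme \<Rightarrow> 'u ring
      \<Rightarrow> nat \<Rightarrow> nat \<Rightarrow> (('u \<Rightarrow> 'u) \<times> 'w set) set" where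
  "L_congruence_kernel \<Gamma> N act G R l n =
     {(g, x) \<in> carrier (L_group \<Gamma> N act G R). x = \<one>\<^bsub>\<Gamma> Mod N\<^esub> \<and>
        (\<forall>a\<in>carrier (coord G). adic_ideal l n R +>\<^bsub>R\<^esub> g a = adic_ideal l n R +>\<^bsub>R\<^esub> \<one>\<^bsub>pts G R\<^esub> a)}"

definition adically_continuous_separated ::
    "'w monoid \<Rightarrow> 'w topology \<Rightarrow> 'w set \<Rightarrow> ('w \<Rightarrow> 'u ring \<Rightarrow> ('u \<Rightarrow> 'u) \<Rightarrow> ('u \<Rightarrow> 'u))
      \<Rightarrow> 'u group_scheme \<Rightarrow> nat \<Rightarrow> 'u ring \<Rightarrow> ((nat \<Rightarrow> int) \<Rightarrow> 'u) \<Rightarrow> ('w \<Rightarrow> ('u \<Rightarrow> 'u)) \<Rightarrow> bool" where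
  "adically_continuous_separated \<Gamma> \<Omega> N act G l C \<eta> \<psi> \<longleftrightarrow>
     zl_algebra l C \<eta> \<and> noetherian_ring C \<and> adically_separated l C \<and> \<psi> \<in> cocycles \<Gamma> act G C \<and>
     (\<forall>n>0. openin \<Omega> {w \<in> carrier \<Gamma>. (\<psi> w, N #>\<^bsub>\<Gamma>\<^esub> w) \<in> L_congruence_kernel \<Gamma> N act G C l n})"

definition adically_continuous ::
    "'w monoid \<Rightarrow> 'w topology \<Rightarrow> 'w set \<Rightarrow> ('w \<Rightarrow> 'u ring \<Rightarrow> ('u \<Rightarrow> 'u) \<Rightarrow> ('u \<Rightarrow> 'u))
      \<Rightarrow> 'u group_scheme \<Rightarrow> nat \<Rightarrow> 'u ring \<Rightarrow> ((nat \<Rightarrow> int) \<Rightarrow> 'u) \<Rightarrow> ('w \<Rightarrow> ('u \<Rightarrow> 'u)) \<Rightarrow> bool" where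
  "adically_continuous \<Gamma> \<Omega> N act G l C \<eta> \<psi> \<longleftrightarrow>
     zl_algebra l C \<eta> \<and> noetherian_ring C \<and> \<psi> \<in> cocycles \<Gamma> act G C \<and>
     (adically_continuous_separated \<Gamma> \<Omega> N act G l C \<eta> \<psi> \<or>
      (\<exists>C' \<eta>' \<psi>' f. adically_continuous_separated \<Gamma> \<Omega> N act G l C' \<eta>' \<psi>' \<and>
         f \<in> zl_hom l C' \<eta>' C \<eta> \<and> \<psi> = push_cocycle \<Gamma> G f \<psi>'))"

definition adically_continuous_on_quotient ::
    "'w monoid \<Rightarrow> 'w topology \<Rightarrow> 'w set \<Rightarrow> 'w set \<Rightarrow> ('w \<Rightarrow> 'u ring \<Rightarrow> ('u \<Rightarrow> 'u) \<Rightarrow> ('u \<Rightarrow> 'u))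
      \<Rightarrow> 'u group_scheme \<Rightarrow> nat \<Rightarrow> 'u ring \<Rightarrow> ((nat \<Rightarrow> int) \<Rightarrow> 'u) \<Rightarrow> ('w set \<Rightarrow> ('u \<Rightarrow> 'u)) \<Rightarrow> bool" where
  "adically_continuous_on_quotient \<Gamma> \<Omega> N P act G l C \<eta> \<psi> \<longleftrightarrow>
     \<psi> \<in> cocycles (\<Gamma> Mod P) (coset_act act) G C \<and>
     adically_continuous \<Gamma> \<Omega> N act G l C \<eta> (\<lambda>w\<in>carrier \<Gamma>. \<psi> (P #>\<^bsub>\<Gamma>\<^esub> w))"

text \<open>\<open>\<phi>\<close> is the universal cocycle on \<open>\<Gamma>\<^sub>0/P\<close> over \<open>R\<close>, and \<open>(T, i, j)\<close> is \<open>R \<otimes> \<int>\<^sub>l\<close>.  Then \<open>\<Phi>\<close> is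
  the continuous extension of \<open>\<phi>\<close> to \<open>\<Gamma>/P\<close> over \<open>T\<close> that is universal among all
  continuous cocycles on \<open>\<Gamma>/P\<close>.\<close>

definition universal_adically_continuous ::
    "'w monoid \<Rightarrow> 'w topology \<Rightarrow> 'w set \<Rightarrow> 'w set \<Rightarrow> ('w \<Rightarrow> 'u ring \<Rightarrow> ('u \<Rightarrow> 'u) \<Rightarrow> ('u \<Rightarrow> 'u))
      \<Rightarrow> 'u group_scheme \<Rightarrow> nat \<Rightarrow> 'w set \<Rightarrow> ('w set \<Rightarrow> ('u \<Rightarrow> 'u))
      \<Rightarrow> 'u ring \<Rightarrow> ('u \<Rightarrow> 'u) \<Rightarrow> ((nat \<Rightarrow> int) \<Rightarrow> 'u) \<Rightarrow> ('w set \<Rightarrow> ('u \<Rightarrow> 'u)) \<Rightarrow> bool" where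
  "universal_adically_continuous \<Gamma> \<Omega> N P act G l \<Gamma>\<^sub>0 \<phi> T i j \<Phi> \<longleftrightarrow>
     adically_continuous_on_quotient \<Gamma> \<Omega> N P act G l T j \<Phi> \<and>
     (\<forall>Y\<in>carrier (\<Gamma>\<lparr>carrier := \<Gamma>\<^sub>0\<rparr> Mod P). \<Phi> Y = push G i (\<phi> Y)) \<and>
     (\<forall>C \<eta> \<psi>. adically_continuous_on_quotient \<Gamma> \<Omega> N P act G l C \<eta> \<psi> \<longrightarrow>
        (\<exists>!f. f \<in> zl_hom l T j C \<eta> \<and> push_cocycle (\<Gamma> Mod P) G f \<Phi> = \<psi>))"

end

theory Submission
  imports Defs
begin

text \<open>Yoneda: both \<open>(T, \<Phi>)\<close> and \<open>(T', \<Phi>')\<close> represent the functor of \<open>\<ell>\<close>-adically continuous cocycles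
  on \<open>W/P\<^sub>e\<close>, which does not mention the subgroups \<open>W\<^sub>0\<close> and \<open>W\<^sub>0'\<close>.\<close>

text \<open>A ring homomorphism carries integer multiples of one to integer multiples of one, and
  units to units, so invertibility of \<open>p\<close> travels along any arrow out of
  \<open>R\<close>.\<close>

lemma zp_algebra_ring_hom:
  assumes "zp_algebra p R" "cring S" "f \<in> ring_hom R S"
  shows "zp_algebra p S"
proof -
  interpret ring_hom_cring R S f
    using assms by (simp add: zp_algebra_def ring_hom_cring_def ring_hom_cring_axioms_def)
  let ?x = "add_pow R p \<one>\<^bsub>R\<^esub>"
  have pow: "f (add_pow R n \<one>\<^bsub>R\<^esub>) = add_pow S n \<one>\<^bsub>S\<^esub>" for n :: nat
    by (induction n) simp_all
  have x: "?x \<in> Units R" using assms by (simp add: zp_algebra_def)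
  \<comment> \<open>The inverse of \<open>p\<close> in \<open>S\<close> is the image of its inverse
    in \<open>R\<close>.\<close>
  have "f ?x \<in> Units S"
    unfolding Units_def
  proof (intro CollectI conjI bexI)
    show "f (inv\<^bsub>R\<^esub> ?x) \<otimes>\<^bsub>S\<^esub> f ?x = \<one>\<^bsub>S\<^esub>"
      using x by (simp flip: hom_mult)
    show "f ?x \<otimes>\<^bsub>S\<^esub> f (inv\<^bsub>R\<^esub> ?x) = \<one>\<^bsub>S\<^esub>"
      using x by (simp flip: hom_mult)
  qed (use x in auto)
  with pow assms(2) show ?thesis by (simp add: zp_algebra_def)
qed

lemma pts_closed:
  assumes "affine_group_scheme p G" "zp_algebra p R" "g \<in> carrier (pts G R)"
  shows "g \<in> alg_hom (coord G) R"
  using assms by (simp add: affine_group_scheme_def)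

text \<open>\<open>compose (carrier R) g f\<close> is cut off outside \<open>carrier R\<close>. The
  two sides agree because each \<open>\<phi> w\<close> is a homomorphism from the coordinate ring to
  \<open>R\<close>, so its values never leave that carrier.\<close>

lemma push_cocycle_compose:
  assumes "affine_group_scheme p G" "zp_algebra p R" "\<phi> \<in> cocycles \<Gamma> act G R"
  shows "push_cocycle \<Gamma> G (compose (carrier R) g f) \<phi> = push_cocycle \<Gamma> G g (push_cocycle \<Gamma> G f \<phi>)"
proof -
  have "\<phi> w a \<in> carrier R" if "w \<in> carrier \<Gamma>" "a \<in> carrier (coord G)" for w a
    using pts_closed[OF assms(1,2), of "\<phi> w"] assms(3) that
    by (auto simp: cocycles_def alg_hom_def ring_hom_def)
  then show ?thesis
    by (auto simp: push_cocycle_def push_def compose_def fun_eq_iff)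
qed

text \<open>The equality is literal, also off the carriers: cocycles are extensional on \<Gamma>,
  and points of \<open>G\<close> are extensional on the coordinate ring.\<close>

lemma push_cocycle_id:
  assumes "affine_group_scheme p G" "zp_algebra p R" "\<phi> \<in> cocycles \<Gamma> act G R"
  shows "push_cocycle \<Gamma> G (\<lambda>x\<in>carrier R. x) \<phi> = \<phi>"
proof
  fix w
  show "push_cocycle \<Gamma> G (\<lambda>x\<in>carrier R. x) \<phi> w = \<phi> w"
  proof (cases "w \<in> carrier \<Gamma>")
    case True
    then have "\<phi> w \<in> alg_hom (coord G) R"
      using assms by (auto simp: cocycles_def intro: pts_closed)
    with True show ?thesis
      by (auto simp: push_cocycle_def push_def compose_def alg_hom_def ring_hom_def extensional_def
          fun_eq_iff)
  next
    case False
    then show ?thesis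
      using assms(3) by (auto simp: push_cocycle_def cocycles_def PiE_def extensional_def)
  qed
qed

lemma zl_hom_compose:
  assumes "f \<in> zl_hom l C \<eta> D \<theta>" "g \<in> zl_hom l D \<theta> E \<kappa>" "zl_algebra l C \<eta>"
  shows "compose (carrier C) g f \<in> zl_hom l C \<eta> E \<kappa>"
proof -
  have f: "f \<in> ring_hom C D" and g: "g \<in> ring_hom D E"
    using assms by (auto simp: zl_hom_def alg_hom_def)
  interpret C: cring C using assms(3) by (simp add: zl_algebra_def)
  have "compose (carrier C) g f \<in> ring_hom C E"
    using f g by (auto simp: ring_hom_def compose_def Pi_iff)
  moreover have "\<eta> a \<in> carrier C" if "a \<in> carrier (padic_integers l)" for a
    using assms(3) that by (auto simp: zl_algebra_def ring_hom_def)
  ultimately show ?thesis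
    using assms(1,2) by (auto simp: zl_hom_def alg_hom_def compose_def)
qed

text \<open>The identity appears in restricted form because \<open>alg_hom\<close> contains only
  extensional functions. This is what lets uniqueness of morphisms be stated as equality of
  functions.\<close>

lemma zl_hom_id:
  assumes "zl_algebra l C \<eta>"
  shows "(\<lambda>x\<in>carrier C. x) \<in> zl_hom l C \<eta> C \<eta>"
proof -
  interpret C: cring C using assms by (simp add: zl_algebra_def)
  show ?thesis
    using assms by (auto simp: zl_hom_def alg_hom_def ring_hom_def zl_algebra_def Pi_iff)
qed

text \<open>Take \<open>T\<close> with \<Phi> itself as the test object: \<open>f\<close> and the
  identity both classify \<Phi>, so the uniqueness half of universality identifies them.\<close>

lemma universal_endomorphism_id:
  assumes "affine_group_scheme p G" "zp_algebra p T"
    and "universal_adically_continuous \<Gamma> \<Omega> N P act G l \<Gamma>\<^sub>0 \<phi> T i j \<Phi>"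
    and "f \<in> zl_hom l T j T j" "push_cocycle (\<Gamma> Mod P) G f \<Phi> = \<Phi>"
  shows "f = (\<lambda>x\<in>carrier T. x)"
proof -
  have \<Phi>: "adically_continuous_on_quotient \<Gamma> \<Omega> N P act G l T j \<Phi>"
    using assms(3) by (simp add: universal_adically_continuous_def)
  then have T: "zl_algebra l T j" and "\<Phi> \<in> cocycles (\<Gamma> Mod P) (coset_act act) G T"
    by (simp_all add: adically_continuous_on_quotient_def adically_continuous_def)
  then have "push_cocycle (\<Gamma> Mod P) G (\<lambda>x\<in>carrier T. x) \<Phi> = \<Phi>"
    using push_cocycle_id assms(1,2) by blast
  moreover have "\<exists>!f. f \<in> zl_hom l T j T j \<and> push_cocycle (\<Gamma> Mod P) G f \<Phi> = \<Phi>"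
    using assms(3) \<Phi> by (simp add: universal_adically_continuous_def)
  ultimately show ?thesis
    using assms(4,5) zl_hom_id[OF T] by blast
qed

text \<open>The map goes from \<open>T'\<close> to \<open>T\<close> because a morphism of affine
  schemes from Spec \<open>T\<close> to Spec \<open>T'\<close> is a homomorphism of coordinate rings
  in the opposite direction.\<close>

lemma universal_adically_continuous_unique_iso:
  assumes G: "affine_group_scheme p G" and T: "zp_algebra p T" and T': "zp_algebra p T'"
    and U: "universal_adically_continuous \<Gamma> \<Omega> N P act G l \<Gamma>\<^sub>0 \<phi> T i j \<Phi>"
    and U': "universal_adically_continuous \<Gamma> \<Omega> N P act G l \<Gamma>\<^sub>0' \<phi>' T' i' j' \<Phi>'"
  shows "\<exists>!\<theta>. \<theta> \<in> ring_iso T' T \<and> \<theta> \<in> zl_hom l T' j' T j \<and>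
              push_cocycle (\<Gamma> Mod P) G \<theta> \<Phi>' = \<Phi>"
proof -
  have \<Phi>: "adically_continuous_on_quotient \<Gamma> \<Omega> N P act G l T j \<Phi>"
    and \<Phi>': "adically_continuous_on_quotient \<Gamma> \<Omega> N P act G l T' j' \<Phi>'"
    using U U' by (simp_all add: universal_adically_continuous_def)
  then have alg: "zl_algebra l T j" "zl_algebra l T' j'"
    and coc: "\<Phi> \<in> cocycles (\<Gamma> Mod P) (coset_act act) G T"
      "\<Phi>' \<in> cocycles (\<Gamma> Mod P) (coset_act act) G T'"
    by (simp_all add: adically_continuous_on_quotient_def adically_continuous_def)
  \<comment> \<open>Universality of \<open>\<Phi>'\<close> is tested on \<Phi>. Uniqueness holds
    here among all \<open>\<int>_l\<close>-homomorphisms, hence among isomorphisms once \<theta> is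
    known to be one.\<close>
  have ex1: "\<exists>!\<theta>. \<theta> \<in> zl_hom l T' j' T j \<and> push_cocycle (\<Gamma> Mod P) G \<theta> \<Phi>' = \<Phi>"
    using U' \<Phi> by (simp add: universal_adically_continuous_def)
  then obtain \<theta> where \<theta>: "\<theta> \<in> zl_hom l T' j' T j" "push_cocycle (\<Gamma> Mod P) G \<theta> \<Phi>' = \<Phi>"
    by blast
  obtain \<rho> where \<rho>: "\<rho> \<in> zl_hom l T j T' j'" "push_cocycle (\<Gamma> Mod P) G \<rho> \<Phi> = \<Phi>'"
    using U \<Phi>' unfolding universal_adically_continuous_def by blast
  \<comment> \<open>The composite sends \<Phi> first to \<open>\<Phi>'\<close> and then back to
    \<Phi>, so it is an endomorphism of the universal pair. The other composite is treated
    symmetrically.\<close>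
  have "compose (carrier T) \<theta> \<rho> = (\<lambda>x\<in>carrier T. x)"
    using \<theta> \<rho> alg
    by (intro universal_endomorphism_id[OF G T U])
      (simp_all add: push_cocycle_compose[OF G T coc(1)] zl_hom_compose)
  then have inv1: "\<theta> (\<rho> x) = x" if "x \<in> carrier T" for x
    using that by (metis compose_eq restrict_apply')
  have "compose (carrier T') \<rho> \<theta> = (\<lambda>x\<in>carrier T'. x)"
    using \<theta> \<rho> alg
    by (intro universal_endomorphism_id[OF G T' U'])
      (simp_all add: push_cocycle_compose[OF G T' coc(2)] zl_hom_compose)
  then have inv2: "\<rho> (\<theta> x) = x" if "x \<in> carrier T'" for x
    using that by (metis compose_eq restrict_apply')
  have hom: "\<theta> \<in> ring_hom T' T" "\<rho> \<in> ring_hom T T'"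
    using \<theta>(1) \<rho>(1) by (simp_all add: zl_hom_def alg_hom_def)
  then have "bij_betw \<theta> (carrier T') (carrier T)"
    using inv1 inv2 by (intro bij_betw_byWitness[where f' = \<rho>]) (auto simp: ring_hom_closed)
  with hom have "\<theta> \<in> ring_iso T' T"
    by (simp add: ring_iso_def)
  with \<theta> ex1 show ?thesis by blast
qed

theorem corollary4p2:
  fixes F :: "'k::field set" and nrm :: "'k \<Rightarrow> real" and p l :: nat
    and G :: "'u group_scheme"
    and act :: "('k \<Rightarrow> 'k) \<Rightarrow> 'u ring \<Rightarrow> ('u \<Rightarrow> 'u) \<Rightarrow> ('u \<Rightarrow> 'u)"
    and N P\<^sub>e Fr s Fr' s' :: "('k \<Rightarrow> 'k) set"
    and R T R' T' :: "'u ring"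
    and \<phi> \<Phi> \<phi>' \<Phi>' :: "('k \<Rightarrow> 'k) set \<Rightarrow> ('u \<Rightarrow> 'u)"
    and i i' :: "'u \<Rightarrow> 'u" and j j' :: "(nat \<Rightarrow> int) \<Rightarrow> 'u"
  defines "W \<equiv> weil_group F nrm" and "\<Omega> \<equiv> weil_topology F nrm"
    and "W\<^sub>0 \<equiv> discrete_weil_group F nrm Fr s"
    and "W\<^sub>0' \<equiv> discrete_weil_group F nrm Fr' s'"
  assumes "nonarch_local_field F nrm p"
    and "split_reductive p G"
    and "group_scheme_action p G W act"
    and "N \<lhd> W" and "openin \<Omega> N" and "finite (carrier (W Mod N))" and "acts_trivially p G act N"
    and "P\<^sub>e \<lhd> W" and "openin (subtopology \<Omega> (wild_inertia F nrm)) P\<^sub>e"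
    and "acts_trivially p G act P\<^sub>e"
    and "Factorial_Ring.prime l" and "l \<noteq> p"
    and "arithmetic_frobenius_lift F nrm Fr" and "tame_generator F nrm s"
    and "arithmetic_frobenius_lift F nrm Fr'" and "tame_generator F nrm s'"
    and "represents_cocycles p G (W\<lparr>carrier := W\<^sub>0\<rparr> Mod P\<^sub>e) (coset_act act) R \<phi>"
    and "represents_cocycles p G (W\<lparr>carrier := W\<^sub>0'\<rparr> Mod P\<^sub>e) (coset_act act) R' \<phi>'"
    and "base_change_zl l R T i j"
    and "base_change_zl l R' T' i' j'"
    and "universal_adically_continuous W \<Omega> N P\<^sub>e act G l W\<^sub>0 \<phi> T i j \<Phi>"
    and "universal_adically_continuous W \<Omega> N P\<^sub>e act G l W\<^sub>0' \<phi>' T' i' j' \<Phi>'"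
  shows "\<exists>!\<theta>. \<theta> \<in> ring_iso T' T \<and> \<theta> \<in> zl_hom l T' j' T j \<and>
              push_cocycle (W Mod P\<^sub>e) G \<theta> \<Phi>' = \<Phi>"
proof -
  have "affine_group_scheme p G"
    using assms(6) by (simp add: split_reductive_def reductive_group_scheme_def)
  \<comment> \<open>The base change provides a commutative ring with a map \<open>i\<close> from
    \<open>R\<close>; \<open>p\<close> becomes a unit in it along \<open>i\<close>. Points of
    \<open>G\<close> are known to be homomorphisms only over rings in which \<open>p\<close> is
    invertible.\<close>
  moreover have "zp_algebra p T"
    using assms(21,23)
    by (auto simp: represents_cocycles_def base_change_zl_def zl_algebra_def
        intro: zp_algebra_ring_hom)
  moreover have "zp_algebra p T'"
    using assms(22,24)
    by (auto simp: represents_cocycles_def base_change_zl_def zl_algebra_def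
        intro: zp_algebra_ring_hom)
  ultimately show ?thesis
    using assms(25,26) by (rule universal_adically_continuous_unique_iso)
qed

end
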